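(* Let $X\subset\{0,1\}^{\mathbb{N}}$ be the shift space $X=\overline{\bigcup_{n\ge0}X_n}$ defined in the context. Then the set of periodic points of $\sigma$ in $X$ is dense in $X$.
   Context: $\mathbb{N}=\{1,2,\dots\}$; $\{0,1\}^{\mathbb{N}}$ carries the product topology and $\sigma$ is the shift map, $\sigma(x)_i=x_{i+1}$. A shift space is a closed $\sigma$-invariant subset. For blocks, $u^\infty=uuu\dots$, $0^\alpha$ is the block of $\alpha$ zeros ($0^0$ is the empty block), and $\|u\|_1$ is the number of $1$'s in $u$. A point $x$ is periodic if $\sigma^p(x)=x$ for some $p\ge1$. A block is a from-$1$-to-$1$ word if it equals $1$ or has the form $1v1$ with $v\in\{0,1\}^*$ (possibly empty). For a shift space $Y\subset\{0,1\}^{\mathbb{N}}$, $\mathcal{G}_m(Y)$ is the set of all from-$1$-to-$1$ words $u$ that occur in some point of $Y$ and satisfy $\|u\|_1\le m$. Construction of $X$: let $X_0=\{0^\infty\}\cup\{0^\alpha10^\infty:\alpha\ge0\}$. Given $X_n$ ($n\ge0$), let $$P_{n+1}=\bigcup_{l=0}^\infty\sigma^l\big(\{(u0^k)^\infty:k\ge2^{2n},\ u\in\mathcal{G}_{2^n}(X_n)\}\big),$$ $$J'_{n+1}=\{0^\alpha u0^\infty:\alpha\ge0,\ u\in\mathcal{G}_{2^n}(X_n)\},$$ $$J''_{n+1}=\{0^\alpha u0^\beta v0^\infty:\alpha\ge0,\ \beta\ge2^{2n},\ u,v\in\mathcal{G}_{2^n}(X_n)\},$$ $J_{n+1}=J'_{n+1}\cup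 J''_{n+1}$, $Y_{n+1}=\overline{P_{n+1}\cup J_{n+1}}$, and $X_{n+1}=X_n\cup Y_{n+1}$. Finally $X=\overline{\bigcup_{n=0}^\infty X_n}$. *)

theory Defs
  imports "HOL-Analysis.Analysis" "HOL-Library.Omega_Words_Fun"
begin

text \<open>
  Points of the full shift on two symbols are functions \<open>nat \<Rightarrow> bool\<close>, where \<open>True\<close> is the symbol 1,
  \<open>False\<close> is the symbol 0, and the first coordinate has index 0. The type \<open>bool\<close> carries the discrete
  topology and the function type the product topology, so \<open>closure\<close> is closure in the full shift.
  Blocks are lists; \<open>\<frown>\<close> prepends a block to a point and \<open>w\<^sup>\<omega>\<close> is the infinite repetition of
  the nonempty block \<open>w\<close>.
\<close>

abbreviation zeros :: "nat \<Rightarrow> bool list" where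
  "zeros k \<equiv> replicate k False"

definition zero_point :: "nat \<Rightarrow> bool" where
  "zero_point = (\<lambda>_. False)"

definition shift_map :: "(nat \<Rightarrow> bool) \<Rightarrow> (nat \<Rightarrow> bool)" where
  "shift_map x = (\<lambda>i. x (Suc i))"

definition periodic_point :: "(nat \<Rightarrow> bool) \<Rightarrow> bool" where
  "periodic_point x \<longleftrightarrow> (\<exists>p\<ge>1. (shift_map ^^ p) x = x)"

definition occurs_in :: "bool list \<Rightarrow> (nat \<Rightarrow> bool) \<Rightarrow> bool" where
  "occurs_in u x \<longleftrightarrow> (\<exists>i. x [i \<rightarrow> i + length u] = u)"

definition from_1_to_1 :: "bool list \<Rightarrow> bool" where
  "from_1_to_1 u \<longleftrightarrow> u = [True] \<or> (\<exists>v. u = [True] @ v @ [True])"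

definition \<G> :: "nat \<Rightarrow> (nat \<Rightarrow> bool) set \<Rightarrow> bool list set" where
  "\<G> m Y = {u. from_1_to_1 u \<and> (\<exists>x\<in>Y. occurs_in u x) \<and> count_list u True \<le> m}"

text \<open>In the next three definitions \<open>Z\<close> stands for \<open>X\<^sub>n\<close>, and the resulting sets are
  \<open>P\<^bsub>n+1\<^esub>\<close>, \<open>J'\<^bsub>n+1\<^esub>\<close> and \<open>J''\<^bsub>n+1\<^esub>\<close>.\<close>

definition P_next :: "nat \<Rightarrow> (nat \<Rightarrow> bool) set \<Rightarrow> (nat \<Rightarrow> bool) set" where
  "P_next n Z =
     (\<Union>l. (shift_map ^^ l) ` {(u @ zeros k)\<^sup>\<omega> | u k. k \<ge> 2 ^ (2 * n) \<and> u \<in> \<G> (2 ^ n) Z})"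

definition J1_next :: "nat \<Rightarrow> (nat \<Rightarrow> bool) set \<Rightarrow> (nat \<Rightarrow> bool) set" where
  "J1_next n Z = {(zeros a @ u) \<frown> zero_point | a u. u \<in> \<G> (2 ^ n) Z}"

definition J2_next :: "nat \<Rightarrow> (nat \<Rightarrow> bool) set \<Rightarrow> (nat \<Rightarrow> bool) set" where
  "J2_next n Z = {(zeros a @ u @ zeros b @ v) \<frown> zero_point | a b u v.
     b \<ge> 2 ^ (2 * n) \<and> u \<in> \<G> (2 ^ n) Z \<and> v \<in> \<G> (2 ^ n) Z}"

primrec X_stage :: "nat \<Rightarrow> (nat \<Rightarrow> bool) set" where
  "X_stage 0 = {zero_point} \<union> {(zeros a @ [True]) \<frown> zero_point | a. True}"
| "X_stage (Suc n) = X_stage n \<union>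
     closure (P_next n (X_stage n) \<union> (J1_next n (X_stage n) \<union> J2_next n (X_stage n)))"

definition X_shift :: "(nat \<Rightarrow> bool) set" where
  "X_shift = closure (\<Union>n. X_stage n)"

end

theory Submission
  imports Defs
begin

text \<open>
  A point \<open>0\<^sup>\<alpha>u0\<^sup>\<infinity>\<close> is the limit, as \<open>k\<close> grows, of shifts of the periodic points \<open>(u0\<^sup>k)\<^sup>\<infinity>\<close>; so
  \<open>J'\<^bsub>n+1\<^esub>\<close> lies in the closure of \<open>P\<^bsub>n+1\<^esub>\<close>. A point \<open>0\<^sup>\<alpha>u0\<^sup>\<beta>v0\<^sup>\<infinity>\<close> of \<open>J''\<^bsub>n+1\<^esub>\<close> shows that the
  word \<open>u0\<^sup>\<beta>v\<close>, which has at most \<open>2\<^bsup>n+1\<^esup>\<close> ones, occurs in \<open>X\<^bsub>n+1\<^esub>\<close>; hence the point lies in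
  \<open>J'\<^bsub>n+2\<^esub>\<close> and is a limit of points of \<open>P\<^bsub>n+2\<^esub>\<close>.
\<close>

text \<open>Convergence in the product topology is coordinatewise, and a sequence in the discrete
  space \<open>bool\<close> converges once it is eventually constant.\<close>

lemma closure_fun_bool_LIMSEQ:
  fixes x :: "nat \<Rightarrow> bool"
  assumes "\<And>k. y k \<in> S" and "\<And>i. eventually (\<lambda>k. y k i = x i) sequentially"
  shows "x \<in> closure S"
proof -
  have "(\<lambda>k. y k i) \<longlonglongrightarrow> x i" for i
    using assms(2) by (rule tendsto_eventually)
  then have "limitin (product_topology (\<lambda>i. euclidean) UNIV) y x sequentially"
    by (simp add: limitin_componentwise)
  then have "y \<longlonglongrightarrow> x"
    by (simp add: euclidean_product_topology)
  then show ?thesis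
    using assms(1) closure_subset[of S]
    by (intro Lim_in_closed_set[of "closure S" y sequentially] always_eventually) auto
qed

lemma funpow_shift_map: "(shift_map ^^ l) x = (\<lambda>i. x (i + l))"
  by (induction l) (auto simp: shift_map_def)

lemma periodic_point_shift_iter:
  assumes "w \<noteq> []"
  shows "periodic_point ((shift_map ^^ l) (w\<^sup>\<omega>))"
  unfolding periodic_point_def
proof (intro exI conjI)
  show "length w \<ge> 1" using assms by (cases w) auto
  have "(i + length w + l) mod length w = (i + l) mod length w" for i
    by (metis add.assoc add.commute mod_add_self2)
  then show "(shift_map ^^ length w) ((shift_map ^^ l) (w\<^sup>\<omega>)) = (shift_map ^^ l) (w\<^sup>\<omega>)"
    using assms by (simp add: funpow_shift_map)
qed

text \<open>The shift leaves only the last \<open>a\<close> zeros of the first period. They are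
  followed by \<open>u\<close> and \<open>k\<close> more zeros, so the agreement range grows with
  \<open>k\<close>.\<close>

lemma shift_iter_agrees:
  assumes "u \<noteq> []" "a \<le> k" "i < length u + k"
  shows "(shift_map ^^ (length u + k - a)) ((u @ zeros k)\<^sup>\<omega>) i = ((zeros a @ u) \<frown> zero_point) i"
proof -
  let ?L = "length u + k"
  have "(shift_map ^^ (?L - a)) ((u @ zeros k)\<^sup>\<omega>) i = (u @ zeros k) ! ((i + (?L - a)) mod ?L)"
    using assms by (simp add: funpow_shift_map)
  also have "\<dots> = ((zeros a @ u) \<frown> zero_point) i"
  proof (cases "i < a")
    case True
    then have "(i + (?L - a)) mod ?L = i + (?L - a)" using assms by simp
    moreover have "\<not> i + (?L - a) < length u" using assms by simp
    ultimately show ?thesis using True assms by (simp add: nth_append conc_def)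
  next
    case False
    \<comment> \<open>Past the first \<open>a\<close> coordinates the index lies in the second
      period, whose position \<open>i - a\<close> is read off.\<close>
    then have "i + (?L - a) = (i - a) + ?L" using assms by simp
    moreover have "i - a < ?L" using assms by linarith
    ultimately have "(i + (?L - a)) mod ?L = i - a" by (simp only: mod_add_self2 mod_less)
    then show ?thesis using False assms by (auto simp: nth_append conc_def zero_point_def)
  qed
  finally show ?thesis .
qed

lemma J1_next_subset_closure_P_next: "J1_next n Z \<subseteq> closure (P_next n Z)"
proof
  fix x assume "x \<in> J1_next n Z"
  then obtain a u where x: "x = (zeros a @ u) \<frown> zero_point" and u: "u \<in> \<G> (2 ^ n) Z"
    by (auto simp: J1_next_def)
  have ne: "u \<noteq> []" using u by (auto simp: \<G>_def from_1_to_1_def)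
  \<comment> \<open>The summand \<open>2 ^ (2 * n)\<close> makes every gap \<open>b + j\<close>
    admissible in \<open>P_next\<close>; the summand \<open>a\<close> provides the leading
    zeros.\<close>
  define b where "b = a + 2 ^ (2 * n)"
  define y where "y j = (shift_map ^^ (length u + (b + j) - a)) ((u @ zeros (b + j))\<^sup>\<omega>)" for j
  have "y j \<in> P_next n Z" for j
    using u unfolding P_next_def y_def b_def by (blast intro: le_add2 trans_le_add1)
  moreover have "eventually (\<lambda>j. y j i = x i) sequentially" for i
    using eventually_gt_at_top[of i]
  proof (rule eventually_mono)
    fix j assume "i < j"
    then show "y j i = x i"
      unfolding x y_def by (intro shift_iter_agrees[OF ne]) (auto simp: b_def)
  qed
  ultimately show "x \<in> closure (P_next n Z)"
    by (rule closure_fun_bool_LIMSEQ)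
qed

lemma from_1_to_1_append:
  assumes "from_1_to_1 u" "from_1_to_1 v"
  shows "from_1_to_1 (u @ w @ v)"
proof -
  from assms(1) obtain u' where u: "u = True # u'"
    by (auto simp: from_1_to_1_def)
  from assms(2) obtain v' where v: "v = v' @ [True]"
    by (auto simp: from_1_to_1_def)
  show ?thesis
    unfolding from_1_to_1_def u v by simp
qed

lemma occurs_in_prefix_conc: "occurs_in u ((w @ u) \<frown> x)"
  unfolding occurs_in_def
  by (rule exI[of _ "length w"]) (auto intro!: nth_equalityI simp: subsequence_def conc_def nth_append)

lemma J2_next_subset_J1_next:
  assumes "J2_next n Z \<subseteq> Z'"
  shows "J2_next n Z \<subseteq> J1_next (Suc n) Z'"
proof
  fix x assume *: "x \<in> J2_next n Z"
  then obtain a b u v where x: "x = (zeros a @ (u @ zeros b @ v)) \<frown> zero_point"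
    and u: "u \<in> \<G> (2 ^ n) Z" and v: "v \<in> \<G> (2 ^ n) Z"
    by (auto simp: J2_next_def)
  \<comment> \<open>The point \<open>x\<close> itself, which lies in \<open>Z'\<close>, witnesses
    that the merged word occurs. The gap adds no ones, so the count is at most 2^n + 2^n.\<close>
  have "occurs_in (u @ zeros b @ v) x"
    unfolding x by (rule occurs_in_prefix_conc)
  moreover have "count_list (zeros b) True = 0"
    by (induction b) auto
  ultimately have "u @ zeros b @ v \<in> \<G> (2 ^ Suc n) Z'"
    using u v * assms from_1_to_1_append by (auto simp: \<G>_def)
  then show "x \<in> J1_next (Suc n) Z'"
    unfolding J1_next_def x by blast
qed

text \<open>The word 1 meets the bound 2^0 on the number of ones, so each 0^a 1 0^\<infinity> has
  the required form; letting \<open>a\<close> grow gives \<open>zero_point\<close> as a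
  limit.\<close>

lemma X_stage_0_subset: "X_stage 0 \<subseteq> closure (J1_next 0 (X_stage 0))"
proof -
  have "(zeros a @ [True]) \<frown> zero_point \<in> X_stage 0" for a
    by auto
  moreover have "occurs_in [True] ((zeros 0 @ [True]) \<frown> zero_point)"
    by (rule occurs_in_prefix_conc)
  ultimately have "\<exists>x\<in>X_stage 0. occurs_in [True] x"
    by blast
  then have "[True] \<in> \<G> (2 ^ 0) (X_stage 0)"
    unfolding \<G>_def from_1_to_1_def by simp
  then have J: "(zeros a @ [True]) \<frown> zero_point \<in> J1_next 0 (X_stage 0)" for a
    unfolding J1_next_def by blast
  have "eventually (\<lambda>a. ((zeros a @ [True]) \<frown> zero_point) i = zero_point i) sequentially" for i
    using eventually_gt_at_top[of i]
    by (rule eventually_mono) (auto simp: nth_append conc_def zero_point_def)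
  then have "zero_point \<in> closure (J1_next 0 (X_stage 0))"
    by (rule closure_fun_bool_LIMSEQ[OF J])
  then show ?thesis
    using J closure_subset by auto
qed

lemma P_next_subset_periodic: "P_next n (X_stage n) \<subseteq> {x \<in> X_shift. periodic_point x}"
proof -
  have "P_next n (X_stage n) \<subseteq> X_stage (Suc n)"
    using closure_subset by fastforce
  also have "\<dots> \<subseteq> X_shift"
    unfolding X_shift_def by (rule order_trans[OF UN_upper[OF UNIV_I] closure_subset])
  finally have "P_next n (X_stage n) \<subseteq> X_shift" .
  moreover have "periodic_point x" if x: "x \<in> P_next n (X_stage n)" for x
  proof -
    obtain l u k where eq: "x = (shift_map ^^ l) ((u @ zeros k)\<^sup>\<omega>)"
      and u: "u \<in> \<G> (2 ^ n) (X_stage n)"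
      using x unfolding P_next_def by blast
    from u have "u @ zeros k \<noteq> []"
      by (auto simp: \<G>_def from_1_to_1_def)
    then show ?thesis
      unfolding eq by (rule periodic_point_shift_iter)
  qed
  ultimately show ?thesis by blast
qed

theorem lemma6:
  shows "X_shift \<subseteq> closure {x \<in> X_shift. periodic_point x}"
proof -
  let ?C = "closure {x \<in> X_shift. periodic_point x}"
  have P: "P_next n (X_stage n) \<subseteq> ?C" for n
    using P_next_subset_periodic closure_subset by blast
  have J1: "J1_next n (X_stage n) \<subseteq> ?C" for n
    using J1_next_subset_closure_P_next closure_mono[OF P_next_subset_periodic] by blast
  \<comment> \<open>This allows \<open>Z'\<close> to be \<open>X_stage (Suc n)\<close>, so that
    \<open>J1\<close> applies one level up.\<close>
  have "J2_next n (X_stage n) \<subseteq> X_stage (Suc n)" for n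
    using closure_subset by fastforce
  then have J2: "J2_next n (X_stage n) \<subseteq> ?C" for n
    using J2_next_subset_J1_next J1 by blast
  have "X_stage n \<subseteq> ?C" for n
  proof (induction n)
    case 0
    show ?case
      using X_stage_0_subset closure_minimal[OF J1 closed_closure] by blast
  next
    case (Suc n)
    \<comment> \<open>Since \<open>?C\<close> is closed, it is enough to bound the three generating
      sets.\<close>
    have "closure (P_next n (X_stage n) \<union> (J1_next n (X_stage n) \<union> J2_next n (X_stage n))) \<subseteq> ?C"
      using P J1 J2 by (intro closure_minimal) auto
    with Suc show ?case by simp
  qed
  then show ?thesis
    by (subst X_shift_def) (intro closure_minimal, auto)
qed

end
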